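(* Let $\{\mathbf{Y}_n\}_{n\ge1}$ be a pMAX process built from $\{\mathbf{X}_n\}_{n\ge1}$, $\{\mathbf{Z}_n\}_{n\ge1}$ and $\boldsymbol{\alpha}=(\alpha_1,\dots,\alpha_d)$, and let $j,j'\in\{1,\dots,d\}$ and $r\in\mathbb N_0$. If the lag-$r$ tail dependence coefficient $\lambda_{jj'}^{(r)}(\mathbf{X})$ exists for the underlying process $\{\mathbf{X}_n\}_{n\ge1}$, then $$\lambda_{jj'}^{(r)}(\mathbf{Y})=\begin{cases}0, & \alpha_j<1,\\[1mm] \tfrac12\,\lambda_{jj'}^{(r)}(\mathbf{X}), & \alpha_j=1,\\[1mm] \lambda_{jj'}^{(r)}(\mathbf{X}), & \alpha_j>1.\end{cases}$$
   Context: Notation: $a\vee b=\max(a,b)$; $\mathbb N_0=\{0,1,2,\dots\}$. pMAX process: $\{\mathbf{X}_n=(X_{n,1},\dots,X_{n,d})\}_{n\ge1}$ is a stationary sequence with a multivariate extremal index, with common distribution function having unit Fréchet marginals $\exp(-1/x)$, $x>0$, and in the domain of attraction of a multivariate extreme value distribution $G$. $\{\mathbf{Z}_n=(Z_{n,1},\dots,Z_{n,d})\}_{n\ge1}$ is an i.i.d. sequence of random vectors, independent of $\{\mathbf{X}_n\}_{n\ge1}$, with common distribution function having unit Fréchet marginals and in the domain of attraction of a multivariate extreme value distribution $H$. $\boldsymbol{\alpha}=(\alpha_1,\dots,\alpha_d)$ is a vector of positive real constants. The pMAX process is $\mathbf{Y}_n=(Y_{n,1},\dots,Y_{n,d})$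 with $Y_{n,j}=X_{n,j}\vee Z_{n,j}^{1/\alpha_j}$. A distribution function $F$ on $\mathbb R^d$ is in the domain of attraction of a multivariate extreme value distribution $G$ if, for some constant vectors $\mathbf a_n$ with positive entries and $\mathbf b_n$, $F^n(\mathbf a_n\mathbf x+\mathbf b_n)\to G(\mathbf x)$ as $n\to\infty$ (operations componentwise), with $G$ non-degenerate. A stationary sequence $\{\mathbf X_n\}$ has multivariate extremal index $\theta(\boldsymbol\tau)\in[0,1]$ if for each $\boldsymbol\tau\in\mathbb R_+^d$ there are levels $\mathbf u_n^{(\boldsymbol\tau)}$ with $n(1-F_{X_{n,j}}(u_{n,j}^{(\tau_j)}))\to\tau_j$ for each $j$, $P(\widehat{\mathbf M}_n\le\mathbf u_n^{(\boldsymbol\tau)})\to\gamma(\boldsymbol\tau)$ and $P(\mathbf M_n\le\mathbf u_n^{(\boldsymbol\tau)})\to\gamma(\boldsymbol\tau)^{\theta(\boldsymbol\tau)}$, with $\mathbf M_n$, $\widehat{\mathbf M}_n$ the componentwise maxima of the first $n$ terms of the sequence and of an i.i.d. sequence with the same common distribution. Lag-$r$ tail dependence coefficient: for a $d$-dimensional stationary sequence $\{\mathbf W_n=(W_{n,1},\dots,W_{n,d})\}_{n\ge1}$ with marginal distributions of upper end-point $+\infty$, $$\lambda_{jj'}^{(r)}(\mathbf W)=\lim_{x\to\infty}P(W_{1+r,j'}>x\mid W_{1,j}>x).$$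
   Formalization: For r = 0 and α_j ≤ 1 the claim fails (j = j' gives coefficient 1 for both X and Y); there it is additionally assumed that the lag-0 tail dependence coefficient of (Z_{n,i}^{1/α_i}) for (j,j') is 0, which is also necessary. All other cases are as stated. *)

theory Defs
  imports "HOL-Probability.Probability"
begin

text \<open>
  Random vectors in d-dimensional space are maps into \<^typ>\<open>real ^ 'd\<close>, and a distribution on that
  space is a Borel probability measure \<open>N\<close>, with distribution function \<open>dfun N\<close> (the order
  on vectors is componentwise). Sequences are indexed by \<open>n \<ge> 1\<close>; the value at index \<open>0\<close> is
  never constrained.
\<close>

definition dfun :: "(real ^ 'd) measure \<Rightarrow> real ^ 'd \<Rightarrow> real" where
  "dfun N x = measure N {y \<in> space N. y \<le> x}"

definition margin_dfun :: "(real ^ 'd) measure \<Rightarrow> 'd \<Rightarrow> real \<Rightarrow> real" where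
  "margin_dfun N j t = measure N {y \<in> space N. y $ j \<le> t}"

definition unit_frechet_margins :: "(real ^ 'd) measure \<Rightarrow> bool" where
  "unit_frechet_margins N \<longleftrightarrow>
     (\<forall>j t. margin_dfun N j t = (if 0 < t then exp (- 1 / t) else 0))"

definition nondegenerate_margins :: "(real ^ 'd) measure \<Rightarrow> bool" where
  "nondegenerate_margins N \<longleftrightarrow> (\<forall>j c. measure N {y \<in> space N. y $ j = c} \<noteq> 1)"

text \<open>
  Multivariate extreme value distributions are by definition the nondegenerate limits \<open>G\<close>
  occurring here, so no separate predicate on \<open>G\<close> is needed. Non-degenerate means, as usual in the
  multivariate setting, that every univariate margin is non-degenerate; \<open>G\<close> is then continuous,
  which is why convergence is required at every point. Sums and products of vectors are
  componentwise.
\<close>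

definition in_domain_of_attraction :: "(real ^ 'd) measure \<Rightarrow> (real ^ 'd) measure \<Rightarrow> bool" where
  "in_domain_of_attraction N G \<longleftrightarrow>
     prob_space G \<and> sets G = sets borel \<and> nondegenerate_margins G \<and>
     (\<exists>a b :: nat \<Rightarrow> real ^ 'd. (\<forall>n j. 0 < a n $ j) \<and>
        (\<forall>x. (\<lambda>n. dfun N (a n * x + b n) ^ n) \<longlonglongrightarrow> dfun G x))"

definition stationary_sequence :: "'w measure \<Rightarrow> (nat \<Rightarrow> 'w \<Rightarrow> real ^ 'd) \<Rightarrow> bool" where
  "stationary_sequence M W \<longleftrightarrow>
     (\<forall>n\<ge>1. W n \<in> measurable M borel) \<and>
     (\<forall>I k. finite I \<longrightarrow> I \<subseteq> {1..} \<longrightarrow>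
        distr M (PiM I (\<lambda>_. borel)) (\<lambda>\<omega>. \<lambda>i\<in>I. W (i + k) \<omega>)
        = distr M (PiM I (\<lambda>_. borel)) (\<lambda>\<omega>. \<lambda>i\<in>I. W i \<omega>))"

definition iid_sequence :: "'w measure \<Rightarrow> (nat \<Rightarrow> 'w \<Rightarrow> real ^ 'd) \<Rightarrow> bool" where
  "iid_sequence M W \<longleftrightarrow>
     prob_space.indep_vars M (\<lambda>_. borel) W {1..} \<and>
     (\<forall>n\<ge>1. distr M borel (W n) = distr M borel (W 1))"

text \<open>The componentwise maximum of the first \<open>n\<close> terms, meaningful for \<open>n \<ge> 1\<close>.\<close>

definition partial_max :: "(nat \<Rightarrow> real ^ 'd) \<Rightarrow> nat \<Rightarrow> real ^ 'd" where
  "partial_max y n = (\<chi> j. Max ((\<lambda>i. y i $ j) ` {1..n}))"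

text \<open>
  The i.i.d. sequence with the same one-dimensional law \<open>N\<close> is realised canonically as the
  coordinate process on the infinite product of \<open>N\<close>. Since \<open>n (1 - F\<^sub>j(u\<^sub>n\<^sub>j)) \<longlonglongrightarrow> \<tau>\<^sub>j\<close> for every \<open>j\<close>
  forces \<open>\<gamma> > 0\<close>, the power \<open>\<gamma> powr \<theta> \<tau>\<close> is the usual one.
\<close>

definition has_extremal_index ::
    "'w measure \<Rightarrow> (nat \<Rightarrow> 'w \<Rightarrow> real ^ 'd) \<Rightarrow> (real ^ 'd \<Rightarrow> real) \<Rightarrow> bool" where
  "has_extremal_index M W \<theta> \<longleftrightarrow>
     (let N = distr M borel (W 1) in
      \<forall>\<tau>. (\<forall>j. 0 < \<tau> $ j) \<longrightarrow>
        0 \<le> \<theta> \<tau> \<and> \<theta> \<tau> \<le> 1 \<and>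
        (\<exists>(u :: nat \<Rightarrow> real ^ 'd) \<gamma>.
           (\<forall>j. (\<lambda>n. real n * (1 - margin_dfun N j (u n $ j))) \<longlonglongrightarrow> \<tau> $ j) \<and>
           (\<lambda>n. \<P>(y in PiM {1..} (\<lambda>_. N). partial_max y n \<le> u n)) \<longlonglongrightarrow> \<gamma> \<and>
           (\<lambda>n. \<P>(\<omega> in M. partial_max (\<lambda>i. W i \<omega>) n \<le> u n)) \<longlonglongrightarrow> \<gamma> powr \<theta> \<tau>))"

definition independent_sequences ::
    "'w measure \<Rightarrow> (nat \<Rightarrow> 'w \<Rightarrow> real ^ 'd) \<Rightarrow> (nat \<Rightarrow> 'w \<Rightarrow> real ^ 'd) \<Rightarrow> bool" where
  "independent_sequences M V W \<longleftrightarrow>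
     prob_space.indep_var M
       (PiM {1..} (\<lambda>_. borel)) (\<lambda>\<omega>. \<lambda>n\<in>{1..}. V n \<omega>)
       (PiM {1..} (\<lambda>_. borel)) (\<lambda>\<omega>. \<lambda>n\<in>{1..}. W n \<omega>)"

locale pmax_model = prob_space M
  for M :: "'w measure" +
  fixes X Z :: "nat \<Rightarrow> 'w \<Rightarrow> real ^ 'd"
    and \<alpha> :: "real ^ 'd"
    and G H :: "(real ^ 'd) measure"
  assumes X_stationary: "stationary_sequence M X"
    and X_extremal_index: "\<exists>\<theta>. has_extremal_index M X \<theta>"
    and X_margins: "unit_frechet_margins (distr M borel (X 1))"
    and X_attraction: "in_domain_of_attraction (distr M borel (X 1)) G"
    and Z_iid: "iid_sequence M Z"
    and Z_margins: "unit_frechet_margins (distr M borel (Z 1))"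
    and Z_attraction: "in_domain_of_attraction (distr M borel (Z 1)) H"
    and X_Z_independent: "independent_sequences M X Z"
    and \<alpha>_pos: "\<forall>j. 0 < \<alpha> $ j"

text \<open>
  Unit Frechet variables are almost surely positive, so \<open>powr\<close> is the usual real power here.
  The components of a single noise vector may be dependent. This matters at lag 0 only, where tail
  dependence of the noise is inherited by the pMAX process: for \<open>r = 0\<close> and \<open>j' = j\<close> the
  coefficient of \<open>X\<close> and of the pMAX process is 1, so it cannot be 0 or half that of the \<open>X\<close> process.
\<close>

definition powered_noise ::
    "(nat \<Rightarrow> 'w \<Rightarrow> real ^ 'd) \<Rightarrow> real ^ 'd \<Rightarrow> nat \<Rightarrow> 'w \<Rightarrow> real ^ 'd" where
  "powered_noise Z \<alpha> n \<omega> = (\<chi> j. (Z n \<omega> $ j) powr (1 / \<alpha> $ j))"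

definition pmax ::
    "(nat \<Rightarrow> 'w \<Rightarrow> real ^ 'd) \<Rightarrow> (nat \<Rightarrow> 'w \<Rightarrow> real ^ 'd) \<Rightarrow> real ^ 'd \<Rightarrow> nat \<Rightarrow> 'w \<Rightarrow> real ^ 'd" where
  "pmax X Z \<alpha> n \<omega> = (\<chi> j. max (X n \<omega> $ j) (powered_noise Z \<alpha> n \<omega> $ j))"

text \<open>
  \<open>has_tail_dependence M W r j j' l\<close> says that the lag-\<open>r\<close> tail dependence coefficient of the pair
  \<open>(j, j')\<close> exists and equals \<open>l\<close>. The conditioning component is \<open>j\<close>, at time 1.
\<close>

definition has_tail_dependence ::
    "'w measure \<Rightarrow> (nat \<Rightarrow> 'w \<Rightarrow> real ^ 'd) \<Rightarrow> nat \<Rightarrow> 'd \<Rightarrow> 'd \<Rightarrow> real \<Rightarrow> bool" where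
  "has_tail_dependence M W r j j' l \<longleftrightarrow>
     ((\<lambda>x. \<P>(\<omega> in M. W (1 + r) \<omega> $ j' > x \<bar> W 1 \<omega> $ j > x)) \<longlongrightarrow> l) at_top"

end

theory Submission
  imports Defs "HOL-Real_Asymp.Real_Asymp"
begin

text \<open>
  The pMAX process exceeds a level \<open>x\<close> at time 1 in component \<open>j\<close> when one of two independent
  events happens: \<open>A\<close>, an exceedance by \<open>X\<close>, of probability \<open>a = 1 - exp (- 1 / x)\<close>, or \<open>B\<close>, an
  exceedance by the powered noise, of probability \<open>b = 1 - exp (- (x powr - \<alpha>\<^sub>j))\<close>. Write \<open>A'\<close> and
  \<open>B'\<close> for the corresponding events at time \<open>1 + r\<close> in component \<open>j'\<close>. A joint exceedance of the pMAX
  process that is not already a joint exceedance \<open>A \<inter> A'\<close> of \<open>X\<close> lies in one of \<open>A' \<inter> B\<close>, \<open>A \<inter> B'\<close>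
  and \<open>B \<inter> B'\<close>. The first two mix \<open>X\<close> with the noise, so each has probability \<open>a\<close> times a factor
  that tends to 0, which is negligible against the probability of \<open>A \<union> B\<close>. The third is
  negligible as well: at a positive lag the noise is independent, at lag 0 with \<open>\<alpha>\<^sub>j \<le> 1\<close> this is
  the assumed tail independence of the noise vector, and for \<open>\<alpha>\<^sub>j > 1\<close> already \<open>b\<close> is negligible
  against \<open>a\<close>.

  Hence the coefficient of the pMAX process is that of \<open>X\<close> multiplied by the limit of
  \<open>a / (a + b - a b)\<close>, the chance that \<open>X\<close> is responsible for a given exceedance
  (\<open>tendsto_tail_dependence_union\<close>). Since \<open>a\<close> behaves like \<open>1 / x\<close> and \<open>b\<close> like
  \<open>x powr - \<alpha>\<^sub>j\<close>, that limit is 0, 1/2 or 1 (\<open>frechet_share\<close>).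
\<close>

section \<open>Tail dependence of a union of independent events\<close>

lemma (in prob_space) prob_joint_union_bounds:
  assumes ev: "A \<in> events" "A' \<in> events" "B \<in> events" "B' \<in> events"
  shows "prob (A \<inter> A') \<le> prob ((A' \<union> B') \<inter> (A \<union> B))"
    and "prob ((A' \<union> B') \<inter> (A \<union> B)) \<le>
           prob (A \<inter> A') + prob (A' \<inter> B) + prob (A \<inter> B') + prob (B \<inter> B')"
proof -
  show "prob (A \<inter> A') \<le> prob ((A' \<union> B') \<inter> (A \<union> B))"
    using ev by (intro finite_measure_mono) auto
  have "(A' \<union> B') \<inter> (A \<union> B) = (A \<inter> A') \<union> (A' \<inter> B) \<union> (A \<inter> B') \<union> (B \<inter> B')"
    by auto
  also have "prob \<dots> \<le> prob ((A \<inter> A') \<union> (A' \<inter> B) \<union> (A \<inter> B')) + prob (B \<inter> B')"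
    using ev by (intro measure_Un_le) auto
  also have "prob ((A \<inter> A') \<union> (A' \<inter> B) \<union> (A \<inter> B'))
      \<le> prob ((A \<inter> A') \<union> (A' \<inter> B)) + prob (A \<inter> B')"
    using ev by (intro measure_Un_le) auto
  also have "prob ((A \<inter> A') \<union> (A' \<inter> B)) \<le> prob (A \<inter> A') + prob (A' \<inter> B)"
    using ev by (intro measure_Un_le) auto
  finally show "prob ((A' \<union> B') \<inter> (A \<union> B)) \<le>
           prob (A \<inter> A') + prob (A' \<inter> B) + prob (A \<inter> B') + prob (B \<inter> B')"
    by simp
qed

text \<open>
  The mixed intersections contribute at most \<open>prob B\<close> and \<open>prob B'\<close> to the quotient, because
  \<open>prob A\<close> is at most the denominator. What remains is the quotient for \<open>A\<close> and \<open>A'\<close>, with its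
  denominator \<open>prob A\<close> replaced by \<open>prob (A \<union> B)\<close>; this is where the factor \<open>c\<close> comes from.
\<close>

lemma (in prob_space) tendsto_tail_dependence_union:
  fixes A A' B B' :: "'b \<Rightarrow> 'a set"
  assumes events: "\<And>x. A x \<in> events" "\<And>x. A' x \<in> events" "\<And>x. B x \<in> events" "\<And>x. B' x \<in> events"
    and indep: "\<And>x. prob (A' x \<inter> B x) = prob (A' x) * prob (B x)"
      "\<And>x. prob (A x \<inter> B' x) = prob (A x) * prob (B' x)"
    and pos: "\<forall>\<^sub>F x in F. 0 < prob (A x)"
    and same: "\<forall>\<^sub>F x in F. prob (A' x) = prob (A x)"
    and B: "((\<lambda>x. prob (B x)) \<longlongrightarrow> 0) F" and B': "((\<lambda>x. prob (B' x)) \<longlongrightarrow> 0) F"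
    and A_A': "((\<lambda>x. prob (A x \<inter> A' x) / prob (A x)) \<longlongrightarrow> l) F"
    and share: "((\<lambda>x. prob (A x) / prob (A x \<union> B x)) \<longlongrightarrow> c) F"
    and B_B': "((\<lambda>x. prob (B x \<inter> B' x) / prob (A x \<union> B x)) \<longlongrightarrow> 0) F"
  shows "((\<lambda>x. prob ((A' x \<union> B' x) \<inter> (A x \<union> B x)) / prob (A x \<union> B x)) \<longlongrightarrow> l * c) F"
proof (rule tendsto_sandwich)
  let ?D = "\<lambda>x. prob (A x \<union> B x)"
  let ?m = "\<lambda>x. prob (A x \<inter> A' x) / prob (A x) * (prob (A x) / ?D x)"
  show "(?m \<longlongrightarrow> l * c) F"
    by (intro tendsto_mult A_A' share)
  show "((\<lambda>x. ?m x + prob (B x) + prob (B' x) + prob (B x \<inter> B' x) / ?D x) \<longlongrightarrow> l * c) F"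
    using tendsto_add[OF tendsto_add[OF tendsto_add[OF tendsto_mult[OF A_A' share] B] B'] B_B']
    by simp
  show "\<forall>\<^sub>F x in F. ?m x \<le> prob ((A' x \<union> B' x) \<inter> (A x \<union> B x)) / ?D x"
    using pos
  proof eventually_elim
    case (elim x)
    then show ?case
      using prob_joint_union_bounds(1)[OF events(1,2,3,4)[of x]] by (simp add: divide_right_mono)
  qed
  show "\<forall>\<^sub>F x in F. prob ((A' x \<union> B' x) \<inter> (A x \<union> B x)) / ?D x
      \<le> ?m x + prob (B x) + prob (B' x) + prob (B x \<inter> B' x) / ?D x"
    using pos same
  proof eventually_elim
    case (elim x)
    have le: "prob (A x) \<le> ?D x"
      using events by (intro finite_measure_mono) auto
    have D: "0 < ?D x"
      using elim le by linarith
    have "prob ((A' x \<union> B' x) \<inter> (A x \<union> B x)) \<le> prob (A x \<inter> A' x) + prob (A x) * prob (B x)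
        + prob (A x) * prob (B' x) + prob (B x \<inter> B' x)"
      using prob_joint_union_bounds(2)[OF events(1,2,3,4)[of x]] elim by (simp add: indep)
    also have "\<dots> \<le> prob (A x \<inter> A' x) + ?D x * prob (B x) + ?D x * prob (B' x)
        + prob (B x \<inter> B' x)"
      using le by (intro add_mono mult_right_mono) auto
    finally have "prob ((A' x \<union> B' x) \<inter> (A x \<union> B x)) / ?D x
        \<le> (prob (A x \<inter> A' x) + ?D x * prob (B x) + ?D x * prob (B' x) + prob (B x \<inter> B' x)) / ?D x"
      by (intro divide_right_mono) auto
    also have "\<dots> = ?m x + prob (B x) + prob (B' x) + prob (B x \<inter> B' x) / ?D x"
      using elim D by (simp add: field_simps)
    finally show ?case .
  qed
qed

section \<open>Frechet tails\<close>

lemma powered_frechet_survival_tendsto_0: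
  assumes "0 < (\<alpha>::real)"
  shows "((\<lambda>x. 1 - exp (- (x powr - \<alpha>))) \<longlongrightarrow> 0) at_top"
  using assms by real_asymp

lemma frechet_survival_quotient_tendsto_0:
  assumes "1 < (\<alpha>::real)"
  shows "((\<lambda>x. (1 - exp (- (x powr - \<alpha>))) / (1 - exp (- 1 / x))) \<longlongrightarrow> 0) at_top"
  using assms by real_asymp

lemma frechet_share:
  fixes \<alpha> :: real
  defines "a \<equiv> \<lambda>x. 1 - exp (- 1 / x)" and "b \<equiv> \<lambda>x. 1 - exp (- (x powr - \<alpha>))"
  assumes "0 < \<alpha>"
  shows "((\<lambda>x. a x / (a x + b x - a x * b x)) \<longlongrightarrow>
           (if \<alpha> < 1 then 0 else if \<alpha> = 1 then 1 / 2 else 1)) at_top"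
proof -
  consider "\<alpha> < 1" | "\<alpha> = 1" | "1 < \<alpha>" by linarith
  then show ?thesis
  proof cases
    case 1
    (* Here b dominates, so the quotient is written in terms of a / b. *)
    with assms(3) have "((\<lambda>x. a x / b x) \<longlongrightarrow> 0) at_top" "(a \<longlongrightarrow> 0) at_top"
      unfolding a_def b_def by real_asymp+
    then have "((\<lambda>x. (a x / b x) / (a x / b x + 1 - a x)) \<longlongrightarrow> 0 / (0 + 1 - 0)) at_top"
      by (intro tendsto_intros) auto
    moreover have "\<forall>\<^sub>F x in at_top. (a x / b x) / (a x / b x + 1 - a x) = a x / (a x + b x - a x * b x)"
      using eventually_gt_at_top[of 0]
    proof eventually_elim
      case (elim x)
      then have "b x \<noteq> 0"
        by (simp add: b_def)
      then have "a x + b x - a x * b x = b x * (a x / b x + 1 - a x)"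
        by (simp add: algebra_simps)
      with \<open>b x \<noteq> 0\<close> show ?case
        by simp
    qed
    ultimately have "((\<lambda>x. a x / (a x + b x - a x * b x)) \<longlongrightarrow> 0) at_top"
      by (simp add: Lim_transform_eventually)
    with 1 show ?thesis by simp
  next
    case 2
    have "((\<lambda>x. a x / (a x + b x - a x * b x)) \<longlongrightarrow> 1 / 2) at_top"
      unfolding a_def b_def 2 by real_asymp
    with 2 show ?thesis by simp
  next
    case 3
    (* Here a dominates, so the quotient is written in terms of b / a. *)
    have "((\<lambda>x. b x / a x) \<longlongrightarrow> 0) at_top" "(b \<longlongrightarrow> 0) at_top"
      using frechet_survival_quotient_tendsto_0[OF 3] powered_frechet_survival_tendsto_0[OF assms(3)]
      unfolding a_def b_def by auto
    then have "((\<lambda>x. 1 / (1 + b x / a x - b x)) \<longlongrightarrow> 1 / (1 + 0 - 0)) at_top"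
      by (intro tendsto_intros) auto
    moreover have "\<forall>\<^sub>F x in at_top. 1 / (1 + b x / a x - b x) = a x / (a x + b x - a x * b x)"
      using eventually_gt_at_top[of 0]
    proof eventually_elim
      case (elim x)
      then have "a x \<noteq> 0"
        by (simp add: a_def)
      then have "a x + b x - a x * b x = a x * (1 + b x / a x - b x)"
        by (simp add: algebra_simps)
      with \<open>a x \<noteq> 0\<close> show ?case
        by simp
    qed
    ultimately have "((\<lambda>x. a x / (a x + b x - a x * b x)) \<longlongrightarrow> 1) at_top"
      by (simp add: Lim_transform_eventually)
    with 3 show ?thesis by simp
  qed
qed

lemma (in prob_space) frechet_margin_survival:
  fixes V :: "'a \<Rightarrow> real ^ 'd"
  assumes V [measurable]: "V \<in> borel_measurable M"
    and margins: "unit_frechet_margins (distr M borel V)"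
  shows "prob {\<omega> \<in> space M. t < V \<omega> $ k} = 1 - (if 0 < t then exp (- 1 / t) else 0)"
proof -
  have "prob {\<omega> \<in> space M. V \<omega> $ k \<le> t} = margin_dfun (distr M borel V) k t"
    unfolding margin_dfun_def by (subst measure_distr) (auto intro!: arg_cong[where f = prob])
  also have "\<dots> = (if 0 < t then exp (- 1 / t) else 0)"
    using margins by (simp add: unit_frechet_margins_def)
  finally have "prob {\<omega> \<in> space M. V \<omega> $ k \<le> t} = \<dots>" .
  moreover have "prob {\<omega> \<in> space M. \<not> V \<omega> $ k \<le> t} = 1 - prob {\<omega> \<in> space M. V \<omega> $ k \<le> t}"
    by (rule prob_neg) measurable
  ultimately show ?thesis
    by (simp add: not_le)
qed

section \<open>The two components of the pMAX process\<close>

lemma stationary_sequence_same_law: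
  assumes stat: "stationary_sequence M W" and n: "1 \<le> n"
  shows "distr M borel (W n) = distr M borel (W 1)"
proof -
  have [measurable]: "W i \<in> borel_measurable M" if "1 \<le> i" for i
    using stat that by (simp add: stationary_sequence_def)
  have *: "distr (distr M (PiM {1} (\<lambda>_. borel)) (\<lambda>\<omega>. \<lambda>i\<in>{1}. W (i + k) \<omega>)) borel (\<lambda>v. v 1)
      = distr M borel (W (1 + k))" for k :: nat
  proof (subst distr_distr)
    show "(\<lambda>\<omega>. \<lambda>i\<in>{1}. W (i + k) \<omega>) \<in> measurable M (PiM {1} (\<lambda>_. borel))"
      by (intro measurable_restrict) auto
    show "(\<lambda>v. v 1) \<in> measurable (PiM {1::nat} (\<lambda>_. borel)) borel"
      by (rule measurable_component_singleton) simp
  qed (simp add: comp_def)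
  have "distr M (PiM {1} (\<lambda>_. borel)) (\<lambda>\<omega>. \<lambda>i\<in>{1}. W (i + (n - 1)) \<omega>)
      = distr M (PiM {1} (\<lambda>_. borel)) (\<lambda>\<omega>. \<lambda>i\<in>{1}. W (i + 0) \<omega>)"
    using stat unfolding stationary_sequence_def by simp
  with *[of "n - 1"] *[of 0] n show ?thesis
    by simp
qed

lemma coordinate_function_measurable:
  "n \<in> I \<Longrightarrow> f \<in> measurable N K \<Longrightarrow> (\<lambda>v. f (v n)) \<in> measurable (PiM I (\<lambda>_. N)) K"
  by (rule measurable_compose[OF measurable_component_singleton])

context pmax_model
begin

lemma X_measurable: "1 \<le> n \<Longrightarrow> X n \<in> borel_measurable M"
  using X_stationary by (simp add: stationary_sequence_def)

lemma Z_measurable: "1 \<le> n \<Longrightarrow> Z n \<in> borel_measurable M"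
  using Z_iid by (auto simp: iid_sequence_def indep_vars_def)

lemma powered_noise_measurable:
  assumes "1 \<le> n"
  shows "(\<lambda>\<omega>. powered_noise Z \<alpha> n \<omega> $ k) \<in> borel_measurable M"
proof -
  have [measurable]: "Z n \<in> borel_measurable M"
    using assms by (rule Z_measurable)
  show ?thesis
    by (simp add: powered_noise_def)
qed

lemma X_survival:
  assumes "1 \<le> n" "0 < x"
  shows "prob {\<omega> \<in> space M. x < X n \<omega> $ k} = 1 - exp (- 1 / x)"
  using frechet_margin_survival[OF X_measurable[OF assms(1)], of x k] assms X_margins
    stationary_sequence_same_law[OF X_stationary assms(1)] by simp

text \<open>
  On positive values \<open>z powr (1 / \<alpha>) > x\<close> is equivalent to \<open>z > x powr \<alpha>\<close>. The power is not monotone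
  on the whole line, so the equivalence is transferred almost surely, using that unit Frechet
  margins give no mass to the nonpositive values.
\<close>

lemma powered_noise_survival:
  assumes n: "1 \<le> n" and x: "0 < x"
  shows "prob {\<omega> \<in> space M. x < powered_noise Z \<alpha> n \<omega> $ k} = 1 - exp (- (x powr - (\<alpha> $ k)))"
proof -
  have Z [measurable]: "Z n \<in> borel_measurable M"
    using n by (rule Z_measurable)
  note [measurable] = powered_noise_measurable[OF n]
  have margins: "unit_frechet_margins (distr M borel (Z n))"
    using Z_iid Z_margins n unfolding iid_sequence_def by metis
  have "prob {\<omega> \<in> space M. 0 < Z n \<omega> $ k} = 1"
    using frechet_margin_survival[OF Z margins, of 0 k] by simp
  then have "AE \<omega> in M. 0 < Z n \<omega> $ k"
    by (subst (asm) prob_Collect_eq_1) auto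
  then have AE_iff: "AE \<omega> in M. x < powered_noise Z \<alpha> n \<omega> $ k \<longleftrightarrow> x powr (\<alpha> $ k) < Z n \<omega> $ k"
  proof eventually_elim
    case (elim \<omega>)
    define y where "y = (Z n \<omega> $ k) powr (1 / \<alpha> $ k)"
    have "0 < y" "0 < \<alpha> $ k"
      using elim \<alpha>_pos by (auto simp: y_def)
    then have "x < y \<longleftrightarrow> x powr (\<alpha> $ k) < y powr (\<alpha> $ k)"
      using x powr_less_mono2[of "\<alpha> $ k" x y] powr_less_cancel2[of "\<alpha> $ k" x y] by auto
    with elim \<open>0 < \<alpha> $ k\<close> show ?case
      by (simp add: powered_noise_def powr_powr y_def)
  qed
  have "prob {\<omega> \<in> space M. x < powered_noise Z \<alpha> n \<omega> $ k}
      = prob {\<omega> \<in> space M. x powr (\<alpha> $ k) < Z n \<omega> $ k}"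
  proof (rule finite_measure_eq_AE)
    show "AE \<omega> in M. \<omega> \<in> {\<omega> \<in> space M. x < powered_noise Z \<alpha> n \<omega> $ k} \<longleftrightarrow>
        \<omega> \<in> {\<omega> \<in> space M. x powr (\<alpha> $ k) < Z n \<omega> $ k}"
      using AE_iff by eventually_elim (simp only: mem_Collect_eq)
    show "{\<omega> \<in> space M. x < powered_noise Z \<alpha> n \<omega> $ k} \<in> events"
      by measurable
    have "{\<omega> \<in> space M. t < Z n \<omega> $ k} \<in> events" for t
      by measurable
    then show "{\<omega> \<in> space M. x powr (\<alpha> $ k) < Z n \<omega> $ k} \<in> events" .
  qed
  also have "\<dots> = 1 - exp (- (x powr - (\<alpha> $ k)))"
    using frechet_margin_survival[OF Z margins] x by (simp add: powr_minus_divide)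
  finally show ?thesis .
qed

lemma X_powered_noise_independent:
  assumes m: "1 \<le> m" and n: "1 \<le> n"
  shows "prob ({\<omega> \<in> space M. x < X m \<omega> $ i} \<inter> {\<omega> \<in> space M. x < powered_noise Z \<alpha> n \<omega> $ k})
    = prob {\<omega> \<in> space M. x < X m \<omega> $ i} * prob {\<omega> \<in> space M. x < powered_noise Z \<alpha> n \<omega> $ k}"
proof -
  have X_coordinate: "(\<lambda>v. v m $ i) \<in> measurable (PiM {1..} (\<lambda>_. borel :: (real ^ 'd) measure)) borel"
    using m by (intro coordinate_function_measurable[where f = "\<lambda>y :: real ^ 'd. y $ i"]) auto
  have Z_coordinate: "(\<lambda>v. (v n $ k) powr (1 / \<alpha> $ k))
      \<in> measurable (PiM {1..} (\<lambda>_. borel :: (real ^ 'd) measure)) borel"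
    using n by (intro coordinate_function_measurable[where f = "\<lambda>y. (y $ k) powr (1 / \<alpha> $ k)"]) auto
  have "indep_var borel ((\<lambda>v. v m $ i) \<circ> (\<lambda>\<omega>. \<lambda>n\<in>{1..}. X n \<omega>))
      borel ((\<lambda>v. (v n $ k) powr (1 / \<alpha> $ k)) \<circ> (\<lambda>\<omega>. \<lambda>n\<in>{1..}. Z n \<omega>))"
    using X_Z_independent X_coordinate Z_coordinate unfolding independent_sequences_def
    by (rule indep_var_compose)
  from indep_varD[OF this, of "{x<..}" "{x<..}"] m n show ?thesis
    by (simp add: comp_def powered_noise_def vimage_def Int_def conj_ac cong: conj_cong)
qed

lemma powered_noise_independent:
  assumes m: "1 \<le> m" and n: "1 \<le> n" and "m \<noteq> n"
  shows "prob ({\<omega> \<in> space M. x < powered_noise Z \<alpha> m \<omega> $ i} \<inter>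
      {\<omega> \<in> space M. x < powered_noise Z \<alpha> n \<omega> $ k})
    = prob {\<omega> \<in> space M. x < powered_noise Z \<alpha> m \<omega> $ i} *
      prob {\<omega> \<in> space M. x < powered_noise Z \<alpha> n \<omega> $ k}"
proof -
  have "indep_var (PiM {m} (\<lambda>_. borel)) (\<lambda>\<omega>. \<lambda>i\<in>{m}. Z i \<omega>) (PiM {n} (\<lambda>_. borel)) (\<lambda>\<omega>. \<lambda>i\<in>{n}. Z i \<omega>)"
    using Z_iid assms unfolding iid_sequence_def
    by (intro indep_var_restrict[where I = "{1..}"]) auto
  then have "indep_var borel ((\<lambda>v. (v m $ i) powr (1 / \<alpha> $ i)) \<circ> (\<lambda>\<omega>. \<lambda>i\<in>{m}. Z i \<omega>))
      borel ((\<lambda>v. (v n $ k) powr (1 / \<alpha> $ k)) \<circ> (\<lambda>\<omega>. \<lambda>i\<in>{n}. Z i \<omega>))"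
    by (intro indep_var_compose coordinate_function_measurable
          [where f = "\<lambda>y. (y $ i) powr (1 / \<alpha> $ i)"] coordinate_function_measurable
          [where f = "\<lambda>y. (y $ k) powr (1 / \<alpha> $ k)"]) auto
  from indep_varD[OF this, of "{x<..}" "{x<..}"] show ?thesis
    by (simp add: comp_def powered_noise_def vimage_def Int_def conj_ac cong: conj_cong)
qed

section \<open>The tail dependence coefficient of the pMAX process\<close>

text \<open>
  Independence of \<open>X\<close> and the noise says nothing about this term of the error estimate. The
  denominator is at least each of the exceedance probabilities \<open>a\<close> of \<open>X\<close> and \<open>b\<close> of the noise at
  time 1. At a positive lag, \<open>b\<close> cancels a factor of the numerator and leaves the noise exceedance
  probability at time \<open>1 + r\<close>. At lag 0 with \<open>\<alpha>\<^sub>j \<le> 1\<close>, dividing by \<open>b\<close> gives the tail dependence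
  quotient of the noise. For \<open>\<alpha>\<^sub>j > 1\<close> the quotient is at most \<open>b / a\<close>.
\<close>

lemma joint_noise_exceedance_negligible:
  assumes tail_indep: "r = 0 \<Longrightarrow> \<alpha> $ j \<le> 1 \<Longrightarrow> has_tail_dependence M (powered_noise Z \<alpha>) 0 j j' 0"
  shows "((\<lambda>x. prob ({\<omega> \<in> space M. x < powered_noise Z \<alpha> 1 \<omega> $ j} \<inter>
                     {\<omega> \<in> space M. x < powered_noise Z \<alpha> (1 + r) \<omega> $ j'}) /
               prob ({\<omega> \<in> space M. x < X 1 \<omega> $ j} \<union>
                     {\<omega> \<in> space M. x < powered_noise Z \<alpha> 1 \<omega> $ j})) \<longlongrightarrow> 0) at_top"
proof -
  note [measurable] = powered_noise_measurable[of 1] powered_noise_measurable[of "1 + r"]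
    X_measurable[of 1]
  define A where "A = (\<lambda>x. {\<omega> \<in> space M. x < X 1 \<omega> $ j})"
  define B where "B = (\<lambda>x. {\<omega> \<in> space M. x < powered_noise Z \<alpha> 1 \<omega> $ j})"
  define B' where "B' = (\<lambda>x. {\<omega> \<in> space M. x < powered_noise Z \<alpha> (1 + r) \<omega> $ j'})"
  have [measurable]: "A x \<in> events" "B x \<in> events" "B' x \<in> events" for x
    unfolding A_def B_def B'_def by measurable
  have A_le: "prob (A x) \<le> prob (A x \<union> B x)" and B_le: "prob (B x) \<le> prob (A x \<union> B x)" for x
    by (auto intro!: finite_measure_mono)
  have \<alpha>: "0 < \<alpha> $ k" for k
    using \<alpha>_pos by simp
  have A: "prob (A x) = 1 - exp (- 1 / x)"
    and B: "prob (B x) = 1 - exp (- (x powr - (\<alpha> $ j)))"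
    and B': "prob (B' x) = 1 - exp (- (x powr - (\<alpha> $ j')))" if "0 < x" for x
    using that unfolding A_def B_def B'_def by (simp_all add: X_survival powered_noise_survival)
  have pos: "0 < prob (A x)" "0 < prob (B x)" if "0 < x" for x
    using that by (simp_all add: A B)
  consider "0 < r" | "r = 0" "\<alpha> $ j \<le> 1" | "1 < \<alpha> $ j" by linarith
  then obtain e where e: "(e \<longlongrightarrow> 0) at_top"
    and le: "\<And>x. 0 < x \<Longrightarrow> prob (B x \<inter> B' x) / prob (A x \<union> B x) \<le> e x"
  proof cases
    case 1
    show ?thesis
    proof (rule that[of "\<lambda>x. 1 - exp (- (x powr - (\<alpha> $ j')))"])
      fix x :: real assume x: "0 < x"
      have "prob (B x \<inter> B' x) = prob (B x) * prob (B' x)"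
        unfolding B_def B'_def using 1 by (intro powered_noise_independent) auto
      also have "\<dots> \<le> prob (A x \<union> B x) * prob (B' x)"
        using B_le by (intro mult_right_mono) auto
      finally show "prob (B x \<inter> B' x) / prob (A x \<union> B x) \<le> 1 - exp (- (x powr - (\<alpha> $ j')))"
        using pos(1)[OF x] A_le[of x] B'[OF x] by (simp add: divide_le_eq mult.commute)
    qed (rule powered_frechet_survival_tendsto_0[OF \<alpha>])
  next
    case 2
    show ?thesis
    proof (rule that[of "\<lambda>x. prob (B x \<inter> B' x) / prob (B x)"])
      show "((\<lambda>x. prob (B x \<inter> B' x) / prob (B x)) \<longlongrightarrow> 0) at_top"
        using tail_indep[OF 2] 2 unfolding has_tail_dependence_def cond_prob_def B_def B'_def
        by (simp add: Int_def conj_ac cong: conj_cong)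
    qed (use pos B_le in \<open>auto intro!: divide_left_mono mult_pos_pos less_le_trans[OF _ B_le]\<close>)
  next
    case 3
    show ?thesis
    proof (rule that[OF frechet_survival_quotient_tendsto_0[OF 3]])
      fix x :: real assume x: "0 < x"
      have "prob (B x \<inter> B' x) / prob (A x \<union> B x) \<le> prob (B x) / prob (A x)"
        using pos[OF x] A_le[of x] by (intro frac_le finite_measure_mono) auto
      then show "prob (B x \<inter> B' x) / prob (A x \<union> B x)
          \<le> (1 - exp (- (x powr - (\<alpha> $ j)))) / (1 - exp (- 1 / x))"
        by (simp add: A B x)
    qed
  qed
  have "((\<lambda>x. prob (B x \<inter> B' x) / prob (A x \<union> B x)) \<longlongrightarrow> 0) at_top"
    using le by (intro tendsto_sandwich[OF _ _ tendsto_const e])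
      (auto intro!: eventually_mono[OF eventually_gt_at_top[of 0]])
  then show ?thesis
    by (simp add: A_def B_def B'_def)
qed

end

theorem proposition2p5:
  fixes M :: "'w measure"
    and X Z :: "nat \<Rightarrow> 'w \<Rightarrow> real ^ 'd"
    and \<alpha> :: "real ^ 'd"
    and G H :: "(real ^ 'd) measure"
    and j j' :: 'd
    and r :: nat
    and l :: real
  assumes "pmax_model M X Z \<alpha> G H"
    and "r = 0 \<Longrightarrow> \<alpha> $ j \<le> 1 \<Longrightarrow> has_tail_dependence M (powered_noise Z \<alpha>) 0 j j' 0"
    and "has_tail_dependence M X r j j' l"
  shows "has_tail_dependence M (pmax X Z \<alpha>) r j j'
           (if \<alpha> $ j < 1 then 0 else if \<alpha> $ j = 1 then l / 2 else l)"
proof -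
  interpret pmax_model M X Z \<alpha> G H
    by fact
  note [measurable] = powered_noise_measurable[of 1] powered_noise_measurable[of "1 + r"]
    X_measurable[of 1] X_measurable[of "1 + r"]
  define A where "A = (\<lambda>x. {\<omega> \<in> space M. x < X 1 \<omega> $ j})"
  define A' where "A' = (\<lambda>x. {\<omega> \<in> space M. x < X (1 + r) \<omega> $ j'})"
  define B where "B = (\<lambda>x. {\<omega> \<in> space M. x < powered_noise Z \<alpha> 1 \<omega> $ j})"
  define B' where "B' = (\<lambda>x. {\<omega> \<in> space M. x < powered_noise Z \<alpha> (1 + r) \<omega> $ j'})"
  let ?c = "if \<alpha> $ j < 1 then 0 else if \<alpha> $ j = 1 then 1 / 2 else 1 :: real"
  have events: "A x \<in> events" "A' x \<in> events" "B x \<in> events" "B' x \<in> events" for x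
    unfolding A_def A'_def B_def B'_def by measurable
  have pos_ev: "\<forall>\<^sub>F x in at_top. 0 < (x :: real)"
    by (rule eventually_gt_at_top)
  have A: "prob (A x) = 1 - exp (- 1 / x)"
    and A': "prob (A' x) = 1 - exp (- 1 / x)"
    and B: "prob (B x) = 1 - exp (- (x powr - (\<alpha> $ j)))"
    and B': "prob (B' x) = 1 - exp (- (x powr - (\<alpha> $ j')))" if "0 < x" for x
    using that unfolding A_def A'_def B_def B'_def
    by (simp_all add: X_survival powered_noise_survival)
  have A'B: "prob (A' x \<inter> B x) = prob (A' x) * prob (B x)"
    and AB': "prob (A x \<inter> B' x) = prob (A x) * prob (B' x)"
    and AB: "prob (A x \<inter> B x) = prob (A x) * prob (B x)" for x
    unfolding A_def A'_def B_def B'_def by (intro X_powered_noise_independent; simp)+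
  have AuB: "prob (A x \<union> B x) = prob (A x) + prob (B x) - prob (A x) * prob (B x)" for x
    using events by (simp add: measure_Un3 AB fmeasurable_eq_sets)
  have "((\<lambda>x. prob ((A' x \<union> B' x) \<inter> (A x \<union> B x)) / prob (A x \<union> B x)) \<longlongrightarrow> l * ?c) at_top"
  proof (rule tendsto_tail_dependence_union)
    show "\<forall>\<^sub>F x in at_top. 0 < prob (A x)" "\<forall>\<^sub>F x in at_top. prob (A' x) = prob (A x)"
      by (rule eventually_mono[OF pos_ev], simp add: A A')+
    show "((\<lambda>x. prob (B x)) \<longlongrightarrow> 0) at_top"
      using powered_frechet_survival_tendsto_0[of "\<alpha> $ j"] \<alpha>_pos
      by (subst tendsto_cong[OF eventually_mono[OF pos_ev B]]) auto
    show "((\<lambda>x. prob (B' x)) \<longlongrightarrow> 0) at_top"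
      using powered_frechet_survival_tendsto_0[of "\<alpha> $ j'"] \<alpha>_pos
      by (subst tendsto_cong[OF eventually_mono[OF pos_ev B']]) auto
    show "((\<lambda>x. prob (A x \<inter> A' x) / prob (A x)) \<longlongrightarrow> l) at_top"
      using assms(3) unfolding has_tail_dependence_def cond_prob_def A_def A'_def
      by (simp add: Int_def conj_ac cong: conj_cong)
    show "((\<lambda>x. prob (A x) / prob (A x \<union> B x)) \<longlongrightarrow> ?c) at_top"
    proof (rule Lim_transform_eventually)
      show "((\<lambda>x. (1 - exp (- 1 / x)) / (1 - exp (- 1 / x) + (1 - exp (- (x powr - (\<alpha> $ j))))
          - (1 - exp (- 1 / x)) * (1 - exp (- (x powr - (\<alpha> $ j)))))) \<longlongrightarrow> ?c) at_top"
        using \<alpha>_pos by (intro frechet_share) simp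
    qed (rule eventually_mono[OF pos_ev], simp add: A B AuB)
    show "((\<lambda>x. prob (B x \<inter> B' x) / prob (A x \<union> B x)) \<longlongrightarrow> 0) at_top"
      unfolding A_def B_def B'_def by (rule joint_noise_exceedance_negligible[OF assms(2)])
  qed (use events A'B AB' in auto)
  moreover have "(A' x \<union> B' x) \<inter> (A x \<union> B x)
      = {\<omega> \<in> space M. x < pmax X Z \<alpha> (1 + r) \<omega> $ j' \<and> x < pmax X Z \<alpha> 1 \<omega> $ j}"
    and "A x \<union> B x = {\<omega> \<in> space M. x < pmax X Z \<alpha> 1 \<omega> $ j}" for x
    unfolding A_def A'_def B_def B'_def by (auto simp: pmax_def)
  ultimately have "has_tail_dependence M (pmax X Z \<alpha>) r j j' (l * ?c)"
    by (simp add: has_tail_dependence_def cond_prob_def)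
  moreover have "l * ?c = (if \<alpha> $ j < 1 then 0 else if \<alpha> $ j = 1 then l / 2 else l)"
    by simp
  ultimately show ?thesis
    by simp
qed

end
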